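(* For every finite topological space $(E,\mathcal{T})$, one has \[(E,\mathcal{T})\sim_{\mathrm{M}}\mathcal{H}_{(E,\mathcal{T})},\] where $\mathcal{H}_{(E,\mathcal{T})}$ is the set of irreducible open subsets of $(E,\mathcal{T})$ ordered by inclusion. That is, the topos $Sh(E,\mathcal{T})$ of sheaves of sets on $(E,\mathcal{T})$ is equivalent to the category of presheaves of sets on the poset $\mathcal{H}_{(E,\mathcal{T})}$.
   Context: Here $\mathcal{T}$ is the set of open subsets of $E$. An open set $U\in\mathcal{T}$ is called irreducible if it is non-empty and for all $V,W\in\mathcal{T}$, $U=V\cup W$ implies $V=U$ or $W=U$. The topos of a topological space is its usual topos of sheaves of sets; the topos of a poset $(P,\leq)$ is the category of functors $(P,\leq)^{op}\to\mathbf{Set}$ (presheaves). $\sim_{\mathrm{M}}$ (Morita equivalence) means that the associated topoi are equivalent categories. *)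

theory Defs
  imports "HOL-Analysis.Abstract_Topology"
begin

(* Hom-sets are indexed by their endpoints and need not be disjoint.  Hence composition and the
   action of a functor on arrows take the endpoints as arguments:
   Comp C a b c g f is "g after f" for f in Hom C a b and g in Hom C b c. *)

record ('o, 'm) category =
  Ob :: "'o set"
  Hom :: "'o \<Rightarrow> 'o \<Rightarrow> 'm set"
  Ident :: "'o \<Rightarrow> 'm"
  Comp :: "'o \<Rightarrow> 'o \<Rightarrow> 'o \<Rightarrow> 'm \<Rightarrow> 'm \<Rightarrow> 'm"

definition is_category :: "('o, 'm) category \<Rightarrow> bool" where
  "is_category C \<longleftrightarrow>
     (\<forall>a\<in>Ob C. Ident C a \<in> Hom C a a) \<and>
     (\<forall>a\<in>Ob C. \<forall>b\<in>Ob C. \<forall>c\<in>Ob C. \<forall>f\<in>Hom C a b. \<forall>g\<in>Hom C b c.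
        Comp C a b c g f \<in> Hom C a c) \<and>
     (\<forall>a\<in>Ob C. \<forall>b\<in>Ob C. \<forall>f\<in>Hom C a b.
        Comp C a a b f (Ident C a) = f \<and> Comp C a b b (Ident C b) f = f) \<and>
     (\<forall>a\<in>Ob C. \<forall>b\<in>Ob C. \<forall>c\<in>Ob C. \<forall>d\<in>Ob C.
        \<forall>f\<in>Hom C a b. \<forall>g\<in>Hom C b c. \<forall>h\<in>Hom C c d.
          Comp C a c d h (Comp C a b c g f) = Comp C a b d (Comp C b c d h g) f)"

record ('o, 'm, 'p, 'n) cfunctor =
  FOb :: "'o \<Rightarrow> 'p"
  FHom :: "'o \<Rightarrow> 'o \<Rightarrow> 'm \<Rightarrow> 'n"

definition is_functor ::
  "('o, 'm) category \<Rightarrow> ('p, 'n) category \<Rightarrow> ('o, 'm, 'p, 'n) cfunctor \<Rightarrow> bool" where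
  "is_functor C D F \<longleftrightarrow>
     (\<forall>a\<in>Ob C. FOb F a \<in> Ob D) \<and>
     (\<forall>a\<in>Ob C. \<forall>b\<in>Ob C. \<forall>f\<in>Hom C a b. FHom F a b f \<in> Hom D (FOb F a) (FOb F b)) \<and>
     (\<forall>a\<in>Ob C. FHom F a a (Ident C a) = Ident D (FOb F a)) \<and>
     (\<forall>a\<in>Ob C. \<forall>b\<in>Ob C. \<forall>c\<in>Ob C. \<forall>f\<in>Hom C a b. \<forall>g\<in>Hom C b c.
        FHom F a c (Comp C a b c g f) =
        Comp D (FOb F a) (FOb F b) (FOb F c) (FHom F b c g) (FHom F a b f))"

definition id_functor :: "('o, 'm, 'o, 'm) cfunctor" where
  "id_functor = \<lparr>FOb = (\<lambda>a. a), FHom = (\<lambda>a b f. f)\<rparr>"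

definition comp_functor ::
  "('p, 'n, 'q, 'k) cfunctor \<Rightarrow> ('o, 'm, 'p, 'n) cfunctor \<Rightarrow> ('o, 'm, 'q, 'k) cfunctor" where
  "comp_functor G F =
     \<lparr>FOb = (\<lambda>a. FOb G (FOb F a)),
      FHom = (\<lambda>a b f. FHom G (FOb F a) (FOb F b) (FHom F a b f))\<rparr>"

definition is_nat_trans ::
  "('o, 'm) category \<Rightarrow> ('p, 'n) category \<Rightarrow> ('o, 'm, 'p, 'n) cfunctor \<Rightarrow>
   ('o, 'm, 'p, 'n) cfunctor \<Rightarrow> ('o \<Rightarrow> 'n) \<Rightarrow> bool" where
  "is_nat_trans C D F G \<eta> \<longleftrightarrow>
     (\<forall>a\<in>Ob C. \<eta> a \<in> Hom D (FOb F a) (FOb G a)) \<and>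
     (\<forall>a\<in>Ob C. \<forall>b\<in>Ob C. \<forall>f\<in>Hom C a b.
        Comp D (FOb F a) (FOb F b) (FOb G b) (\<eta> b) (FHom F a b f) =
        Comp D (FOb F a) (FOb G a) (FOb G b) (FHom G a b f) (\<eta> a))"

definition is_iso :: "('o, 'm) category \<Rightarrow> 'o \<Rightarrow> 'o \<Rightarrow> 'm \<Rightarrow> bool" where
  "is_iso C a b f \<longleftrightarrow>
     f \<in> Hom C a b \<and>
     (\<exists>g\<in>Hom C b a. Comp C a b a g f = Ident C a \<and> Comp C b a b f g = Ident C b)"

definition naturally_isomorphic ::
  "('o, 'm) category \<Rightarrow> ('p, 'n) category \<Rightarrow> ('o, 'm, 'p, 'n) cfunctor \<Rightarrow>
   ('o, 'm, 'p, 'n) cfunctor \<Rightarrow> bool" where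
  "naturally_isomorphic C D F G \<longleftrightarrow>
     (\<exists>\<eta>. is_nat_trans C D F G \<eta> \<and> (\<forall>a\<in>Ob C. is_iso D (FOb F a) (FOb G a) (\<eta> a)))"

definition equivalent_categories :: "('o, 'm) category \<Rightarrow> ('p, 'n) category \<Rightarrow> bool" where
  "equivalent_categories C D \<longleftrightarrow>
     is_category C \<and> is_category D \<and>
     (\<exists>F G. is_functor C D F \<and> is_functor D C G \<and>
        naturally_isomorphic C C (comp_functor G F) id_functor \<and>
        naturally_isomorphic D D (comp_functor F G) id_functor)"

definition op_cat :: "('o, 'm) category \<Rightarrow> ('o, 'm) category" where
  "op_cat C =
     \<lparr>Ob = Ob C, Hom = (\<lambda>a b. Hom C b a), Ident = Ident C,
      Comp = (\<lambda>a b c g f. Comp C c b a f g)\<rparr>"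

definition full_subcat :: "('o, 'm) category \<Rightarrow> ('o \<Rightarrow> bool) \<Rightarrow> ('o, 'm) category" where
  "full_subcat C P = C\<lparr>Ob := {a \<in> Ob C. P a}\<rparr>"

(* Functors and natural transformations have a fixed value outside their domain, so that HOL
   equality of objects and arrows of the functor category is the mathematical one. *)

definition extensional_functor ::
  "('o, 'm) category \<Rightarrow> ('o, 'm, 'p, 'n) cfunctor \<Rightarrow> bool" where
  "extensional_functor C F \<longleftrightarrow>
     (\<forall>a. a \<notin> Ob C \<longrightarrow> FOb F a = undefined) \<and>
     (\<forall>a b f. \<not> (a \<in> Ob C \<and> b \<in> Ob C \<and> f \<in> Hom C a b) \<longrightarrow> FHom F a b f = undefined)"

definition functor_cat ::
  "('o, 'm) category \<Rightarrow> ('p, 'n) category \<Rightarrow> (('o, 'm, 'p, 'n) cfunctor, 'o \<Rightarrow> 'n) category"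
where
  "functor_cat C D =
     \<lparr>Ob = {F. is_functor C D F \<and> extensional_functor C F},
      Hom = (\<lambda>F G. {\<eta>. is_nat_trans C D F G \<eta> \<and> \<eta> \<in> extensional (Ob C)}),
      Ident = (\<lambda>F. \<lambda>a\<in>Ob C. Ident D (FOb F a)),
      Comp = (\<lambda>F G H \<theta> \<eta>. \<lambda>a\<in>Ob C. Comp D (FOb F a) (FOb G a) (FOb H a) (\<theta> a) (\<eta> a))\<rparr>"

(* HOL has no type of all sets, so Set is taken relative to a collection \<U> of "small" sets.
   Only closure under subsets and (up to bijection) finite products is demanded: this holds for
   all subsets of an arbitrary infinite type (see set_universe_UNIV), and it holds for the members
   of a Grothendieck universe.  Results for every such \<U> thus cover all usual readings of Set. *)

definition set_universe :: "'u set set \<Rightarrow> bool" where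
  "set_universe \<U> \<longleftrightarrow>
     (\<exists>A\<in>\<U>. A \<noteq> {}) \<and>
     (\<forall>A\<in>\<U>. \<forall>B. B \<subseteq> A \<longrightarrow> B \<in> \<U>) \<and>
     (\<forall>A\<in>\<U>. \<forall>B\<in>\<U>. \<exists>C\<in>\<U>. \<exists>f. bij_betw f (A \<times> B) C)"

lemma set_universe_UNIV:
  assumes "infinite (UNIV :: 'u set)"
  shows "set_universe (UNIV :: 'u set set)"
proof -
  obtain h :: "'u \<times> 'u \<Rightarrow> 'u" where h: "bij_betw h (UNIV \<times> UNIV) UNIV"
    using card_of_Times_same_infinite[OF assms] card_of_ordIso[of "UNIV \<times> UNIV"] by blast
  have "bij_betw h (A \<times> B) (h ` (A \<times> B))" for A B
    using h by (rule bij_betw_subset) auto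
  then show ?thesis
    unfolding set_universe_def by blast
qed

definition set_cat :: "'u set set \<Rightarrow> ('u set, 'u \<Rightarrow> 'u) category" where
  "set_cat \<U> =
     \<lparr>Ob = \<U>, Hom = (\<lambda>A B. A \<rightarrow>\<^sub>E B), Ident = (\<lambda>A. \<lambda>x\<in>A. x),
      Comp = (\<lambda>A B C g f. compose A g f)\<rparr>"

definition poset_cat :: "'p set \<Rightarrow> ('p \<Rightarrow> 'p \<Rightarrow> bool) \<Rightarrow> ('p, unit) category" where
  "poset_cat P le =
     \<lparr>Ob = P, Hom = (\<lambda>a b. {u. le a b}), Ident = (\<lambda>a. ()), Comp = (\<lambda>a b c g f. ())\<rparr>"

type_synonym ('p, 'u) presheaf = "('p, unit, 'u set, 'u \<Rightarrow> 'u) cfunctor"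

definition poset_topos ::
  "'u set set \<Rightarrow> 'p set \<Rightarrow> ('p \<Rightarrow> 'p \<Rightarrow> bool) \<Rightarrow> (('p, 'u) presheaf, 'p \<Rightarrow> 'u \<Rightarrow> 'u) category"
where
  "poset_topos \<U> P le = functor_cat (op_cat (poset_cat P le)) (set_cat \<U>)"

(* In the opposite of the poset of open sets, the arrow from V to W (for W \<subseteq> V) is sent to the
   restriction map from V to W. *)

definition restr :: "('a set, 'u) presheaf \<Rightarrow> 'a set \<Rightarrow> 'a set \<Rightarrow> 'u \<Rightarrow> 'u" where
  "restr F V W = FHom F V W ()"

(* Covers are sets of open sets; the empty cover of {} is included. *)

definition is_sheaf :: "'a topology \<Rightarrow> ('a set, 'u) presheaf \<Rightarrow> bool" where
  "is_sheaf X F \<longleftrightarrow>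
     (\<forall>\<V> s. (\<forall>V\<in>\<V>. openin X V) \<longrightarrow>
        (\<forall>V\<in>\<V>. s V \<in> FOb F V) \<longrightarrow>
        (\<forall>V\<in>\<V>. \<forall>W\<in>\<V>. restr F V (V \<inter> W) (s V) = restr F W (V \<inter> W) (s W)) \<longrightarrow>
        (\<exists>!t. t \<in> FOb F (\<Union>\<V>) \<and> (\<forall>V\<in>\<V>. restr F (\<Union>\<V>) V t = s V)))"

definition sheaf_topos ::
  "'u set set \<Rightarrow> 'a topology \<Rightarrow> (('a set, 'u) presheaf, 'a set \<Rightarrow> 'u \<Rightarrow> 'u) category" where
  "sheaf_topos \<U> X = full_subcat (poset_topos \<U> {U. openin X U} (\<subseteq>)) (is_sheaf X)"

definition irreducible_open :: "'a topology \<Rightarrow> 'a set \<Rightarrow> bool" where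
  "irreducible_open X U \<longleftrightarrow>
     openin X U \<and> U \<noteq> {} \<and>
     (\<forall>V W. openin X V \<longrightarrow> openin X W \<longrightarrow> U = V \<union> W \<longrightarrow> V = U \<or> W = U)"

end

theory Submission
  imports Defs
begin

text \<open>
  Restriction of a sheaf to the irreducible open sets is an equivalence.  Since \<open>X\<close> is finite, every
  open set is the union of its irreducible open subsets, so a section of a sheaf over \<open>U\<close> amounts to a
  matching family of sections over the irreducible open \<open>V \<subseteq> U\<close>; hence restriction is fully faithful.
  Conversely, an irreducible open set contained in a union of open sets is contained in one of
  them, so for every presheaf on the irreducible open sets the matching families form a sheaf, which
  restricts to the given presheaf up to isomorphism.
\<close>

section \<open>Fully faithful and essentially surjective functors\<close>

text \<open>The inverse on objects is the right Kan extension along the inclusion of the irreducible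
  open sets: its value at \<open>U\<close> is the limit of \<open>P\<close> over the irreducible
  open \<open>V \<subseteq> U\<close>. Only restriction is made into a functor; the quasi-inverse
  comes out of full faithfulness and essential surjectivity, so the extension never has to be
  defined on arrows. Two obstacles shape the details. The intersection of two irreducible open sets
  is in general not irreducible, so compatibility in the sheaf axiom has to be compared with
  compatibility along nested irreducible sets. And a limit of members of \<open>\<U>\<close>
  consists of functions, not of elements of \<open>'u\<close>, so it must be coded back into
  \<open>\<U>\<close>: finiteness of the space makes it a subset of a finite product, which the
  closure properties of \<open>\<U>\<close> can absorb. Finiteness also drives the decomposition of
  open sets and makes every cover finite.\<close>

lemma category_ident: "is_category C \<Longrightarrow> a \<in> Ob C \<Longrightarrow> Ident C a \<in> Hom C a a"
  by (simp add: is_category_def)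

lemma category_comp:
  "is_category C \<Longrightarrow> a \<in> Ob C \<Longrightarrow> b \<in> Ob C \<Longrightarrow> c \<in> Ob C \<Longrightarrow> f \<in> Hom C a b \<Longrightarrow> g \<in> Hom C b c \<Longrightarrow>
   Comp C a b c g f \<in> Hom C a c"
  by (simp add: is_category_def)

lemma category_id_right:
  "is_category C \<Longrightarrow> a \<in> Ob C \<Longrightarrow> b \<in> Ob C \<Longrightarrow> f \<in> Hom C a b \<Longrightarrow> Comp C a a b f (Ident C a) = f"
  by (simp add: is_category_def)

lemma category_id_left:
  "is_category C \<Longrightarrow> a \<in> Ob C \<Longrightarrow> b \<in> Ob C \<Longrightarrow> f \<in> Hom C a b \<Longrightarrow> Comp C a b b (Ident C b) f = f"
  by (simp add: is_category_def)

lemma category_assoc: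
  "is_category C \<Longrightarrow> a \<in> Ob C \<Longrightarrow> b \<in> Ob C \<Longrightarrow> c \<in> Ob C \<Longrightarrow> d \<in> Ob C \<Longrightarrow>
   f \<in> Hom C a b \<Longrightarrow> g \<in> Hom C b c \<Longrightarrow> h \<in> Hom C c d \<Longrightarrow>
   Comp C a b d (Comp C b c d h g) f = Comp C a c d h (Comp C a b c g f)"
  by (simp add: is_category_def)

text \<open>Choice gives for each \<open>d\<close> an object \<open>s d\<close> and mutually inverse
  arrows \<open>\<epsilon> d\<close>, \<open>\<delta> d\<close> between \<open>R (s d)\<close> and
  \<open>d\<close>. The quasi-inverse sends \<open>g\<close> to the unique preimage under
  \<open>R\<close> of \<open>g\<close> conjugated by these isomorphisms. Every equation in
  \<open>C\<close> is checked after applying \<open>R\<close>, by faithfulness.\<close>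

lemma equivalent_categories_if_fully_faithful:
  assumes C: "is_category C" and D: "is_category D" and R: "is_functor C D R"
    and ff: "\<And>a b. a \<in> Ob C \<Longrightarrow> b \<in> Ob C \<Longrightarrow>
      bij_betw (FHom R a b) (Hom C a b) (Hom D (FOb R a) (FOb R b))"
    and es: "\<And>d. d \<in> Ob D \<Longrightarrow> \<exists>c\<in>Ob C. \<exists>f. is_iso D (FOb R c) d f"
  shows "equivalent_categories C D"
proof -
  define r where "r = FOb R"
  have R_ob: "r a \<in> Ob D" if "a \<in> Ob C" for a
    using R that by (simp add: is_functor_def r_def)
  have R_hom: "FHom R a b f \<in> Hom D (r a) (r b)"
    if "a \<in> Ob C" "b \<in> Ob C" "f \<in> Hom C a b" for a b f
    using R that by (simp add: is_functor_def r_def)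
  have R_id: "FHom R a a (Ident C a) = Ident D (r a)" if "a \<in> Ob C" for a
    using R that by (simp add: is_functor_def r_def)
  have R_comp: "FHom R a c (Comp C a b c g f) = Comp D (r a) (r b) (r c) (FHom R b c g) (FHom R a b f)"
    if "a \<in> Ob C" "b \<in> Ob C" "c \<in> Ob C" "f \<in> Hom C a b" "g \<in> Hom C b c" for a b c f g
    using R that by (simp add: is_functor_def r_def)
  define q where "q a b = inv_into (Hom C a b) (FHom R a b)" for a b
  have q_hom: "q a b g \<in> Hom C a b" and R_q: "FHom R a b (q a b g) = g"
    if "a \<in> Ob C" "b \<in> Ob C" "g \<in> Hom D (r a) (r b)" for a b g
    using ff[OF that(1,2)] that(3) unfolding q_def r_def
    by (metis bij_betw_imp_surj_on inv_into_into, metis bij_betw_inv_into_right)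
  have faithful: "f = g" if "a \<in> Ob C" "b \<in> Ob C" "f \<in> Hom C a b" "g \<in> Hom C a b"
    "FHom R a b f = FHom R a b g" for a b f g
    using ff[OF that(1,2)] that(3-) by (meson bij_betw_imp_inj_on inj_onD)
  note [simp] = category_ident[OF C] category_ident[OF D] category_comp[OF C] category_comp[OF D]
    category_id_left[OF C] category_id_left[OF D] category_id_right[OF C] category_id_right[OF D]
    R_ob R_hom R_id R_comp q_hom R_q
  have "\<exists>c f g. c \<in> Ob C \<and> f \<in> Hom D (r c) d \<and> g \<in> Hom D d (r c) \<and>
    Comp D (r c) d (r c) g f = Ident D (r c) \<and> Comp D d (r c) d f g = Ident D d" if "d \<in> Ob D" for d
    using es[OF that] unfolding is_iso_def r_def by blast
  then obtain s \<epsilon> \<delta> where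
    s [simp]: "\<And>d. d \<in> Ob D \<Longrightarrow> s d \<in> Ob C"
    and \<epsilon> [simp]: "\<And>d. d \<in> Ob D \<Longrightarrow> \<epsilon> d \<in> Hom D (r (s d)) d"
    and \<delta> [simp]: "\<And>d. d \<in> Ob D \<Longrightarrow> \<delta> d \<in> Hom D d (r (s d))"
    and \<delta>\<epsilon> [simp]: "\<And>d. d \<in> Ob D \<Longrightarrow> Comp D (r (s d)) d (r (s d)) (\<delta> d) (\<epsilon> d) = Ident D (r (s d))"
    and \<epsilon>\<delta> [simp]: "\<And>d. d \<in> Ob D \<Longrightarrow> Comp D d (r (s d)) d (\<epsilon> d) (\<delta> d) = Ident D d"
    by metis
  \<comment> \<open>The inverse law in right-nested form, which is the shape that
    \<open>category_assoc\<close> produces.\<close>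
  have \<epsilon>\<delta>_cancel [simp]: "Comp D a (r (s d)) d (\<epsilon> d) (Comp D a d (r (s d)) (\<delta> d) f) = f"
    if "a \<in> Ob D" "d \<in> Ob D" "f \<in> Hom D a d" for a d f
    using that by (simp add: category_assoc[OF D, symmetric])
  define conj where "conj d e g = Comp D (r (s d)) e (r (s e)) (\<delta> e) (Comp D (r (s d)) d e g (\<epsilon> d))" for d e g
  have conj_hom [simp]: "conj d e g \<in> Hom D (r (s d)) (r (s e))"
    if "d \<in> Ob D" "e \<in> Ob D" "g \<in> Hom D d e" for d e g
    using that by (simp add: conj_def)
  have \<epsilon>_conj: "Comp D (r (s d)) (r (s e)) e (\<epsilon> e) (conj d e g) = Comp D (r (s d)) d e g (\<epsilon> d)"
    if "d \<in> Ob D" "e \<in> Ob D" "g \<in> Hom D d e" for d e g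
    using that by (simp add: conj_def)
  have conj_comp: "conj a c (Comp D a b c g f) =
      Comp D (r (s a)) (r (s b)) (r (s c)) (conj b c g) (conj a b f)"
    if "a \<in> Ob D" "b \<in> Ob D" "c \<in> Ob D" "f \<in> Hom D a b" "g \<in> Hom D b c" for a b c f g
  proof -
    have "Comp D (r (s a)) (r (s b)) (r (s c)) (conj b c g) (conj a b f) =
        Comp D (r (s a)) c (r (s c)) (\<delta> c) (Comp D (r (s a)) b c g
          (Comp D (r (s a)) (r (s b)) b (\<epsilon> b) (conj a b f)))"
      unfolding conj_def[of b c] using that by (simp add: category_assoc[OF D])
    also have "\<dots> = conj a c (Comp D a b c g f)"
      using that by (simp add: \<epsilon>_conj) (simp add: conj_def category_assoc[OF D])
    finally show ?thesis by simp
  qed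
  define G where "G = \<lparr>FOb = s, FHom = (\<lambda>d e g. q (s d) (s e) (conj d e g))\<rparr>"
  have G: "is_functor D C G"
    unfolding is_functor_def
  proof (intro conjI ballI)
    fix a assume a: "a \<in> Ob D"
    show "FHom G a a (Ident D a) = Ident C (FOb G a)"
      using a by (intro faithful[of "s a" "s a"]) (simp_all add: G_def, simp add: conj_def)
  next
    fix a b c f g assume "a \<in> Ob D" "b \<in> Ob D" "c \<in> Ob D" "f \<in> Hom D a b" "g \<in> Hom D b c"
    then show "FHom G a c (Comp D a b c g f) =
        Comp C (FOb G a) (FOb G b) (FOb G c) (FHom G b c g) (FHom G a b f)"
      by (intro faithful[of "s a" "s c"]) (simp_all add: G_def conj_comp)
  qed (simp_all add: G_def)
  have "naturally_isomorphic D D (comp_functor R G) id_functor"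
    unfolding naturally_isomorphic_def is_nat_trans_def is_iso_def
  proof (intro exI[of _ \<epsilon>] conjI ballI)
    fix a assume "a \<in> Ob D"
    then show "\<exists>g\<in>Hom D (FOb id_functor a) (FOb (comp_functor R G) a).
      Comp D (FOb (comp_functor R G) a) (FOb id_functor a) (FOb (comp_functor R G) a) g (\<epsilon> a) =
        Ident D (FOb (comp_functor R G) a) \<and>
      Comp D (FOb id_functor a) (FOb (comp_functor R G) a) (FOb id_functor a) (\<epsilon> a) g =
        Ident D (FOb id_functor a)"
      by (intro bexI[of _ "\<delta> a"]) (simp_all add: comp_functor_def id_functor_def G_def flip: r_def)
  qed (simp_all add: comp_functor_def id_functor_def G_def \<epsilon>_conj flip: r_def)
  moreover have "naturally_isomorphic C C (comp_functor G R) id_functor"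
    unfolding naturally_isomorphic_def is_nat_trans_def is_iso_def
  \<comment> \<open>The component at \<open>c\<close> is the arrow that \<open>R\<close> sends to
    \<open>\<epsilon> (r c)\<close>; its naturality and its inverse are pulled back from
    \<open>D\<close>.\<close>
  proof (intro exI[of _ "\<lambda>c. q (s (r c)) c (\<epsilon> (r c))"] conjI ballI)
    fix a b f assume ab: "a \<in> Ob C" "b \<in> Ob C" "f \<in> Hom C a b"
    have "Comp C (s (r a)) (s (r b)) b (q (s (r b)) b (\<epsilon> (r b)))
        (q (s (r a)) (s (r b)) (conj (r a) (r b) (FHom R a b f))) =
      Comp C (s (r a)) a b f (q (s (r a)) a (\<epsilon> (r a)))"
      using ab by (intro faithful[of "s (r a)" b]) (simp_all add: \<epsilon>_conj)
    then show "Comp C (FOb (comp_functor G R) a) (FOb (comp_functor G R) b) (FOb id_functor b)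
        (q (s (r b)) b (\<epsilon> (r b))) (FHom (comp_functor G R) a b f) =
      Comp C (FOb (comp_functor G R) a) (FOb id_functor a) (FOb id_functor b)
        (FHom id_functor a b f) (q (s (r a)) a (\<epsilon> (r a)))"
      by (simp add: comp_functor_def id_functor_def G_def flip: r_def)
  next
    fix a assume a: "a \<in> Ob C"
    have "Comp C (s (r a)) a (s (r a)) (q a (s (r a)) (\<delta> (r a))) (q (s (r a)) a (\<epsilon> (r a))) =
      Ident C (s (r a))"
      using a by (intro faithful[of "s (r a)" "s (r a)"]) simp_all
    moreover have "Comp C a (s (r a)) a (q (s (r a)) a (\<epsilon> (r a))) (q a (s (r a)) (\<delta> (r a))) = Ident C a"
      using a by (intro faithful[of a a]) simp_all
    ultimately show "\<exists>g\<in>Hom C (FOb id_functor a) (FOb (comp_functor G R) a).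
      Comp C (FOb (comp_functor G R) a) (FOb id_functor a) (FOb (comp_functor G R) a) g
        (q (s (r a)) a (\<epsilon> (r a))) = Ident C (FOb (comp_functor G R) a) \<and>
      Comp C (FOb id_functor a) (FOb (comp_functor G R) a) (FOb id_functor a)
        (q (s (r a)) a (\<epsilon> (r a))) g = Ident C (FOb id_functor a)"
      using a by (intro bexI[of _ "q a (s (r a)) (\<delta> (r a))"])
        (simp_all add: comp_functor_def id_functor_def G_def flip: r_def)
  qed (simp_all add: comp_functor_def id_functor_def G_def flip: r_def)
  ultimately show ?thesis
    unfolding equivalent_categories_def using C D R G by blast
qed

section \<open>Categories of presheaves\<close>

lemma set_cat_simps [simp]:
  "Ob (set_cat \<U>) = \<U>" "Hom (set_cat \<U>) A B = A \<rightarrow>\<^sub>E B" "Ident (set_cat \<U>) A = (\<lambda>x\<in>A. x)"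
  "Comp (set_cat \<U>) A B C g f = compose A g f"
  by (simp_all add: set_cat_def)

lemma op_poset_cat_simps [simp]:
  "Ob (op_cat (poset_cat P le)) = P" "Hom (op_cat (poset_cat P le)) a b = {u. le b a}"
  "Ident (op_cat (poset_cat P le)) a = ()" "Comp (op_cat (poset_cat P le)) a b c v u = ()"
  by (simp_all add: op_cat_def poset_cat_def)

lemma full_subcat_simps [simp]:
  "Ob (full_subcat C Q) = {a \<in> Ob C. Q a}" "Hom (full_subcat C Q) = Hom C"
  "Ident (full_subcat C Q) = Ident C" "Comp (full_subcat C Q) = Comp C"
  by (simp_all add: full_subcat_def)

lemma is_category_full_subcat: "is_category C \<Longrightarrow> is_category (full_subcat C Q)"
  by (simp add: is_category_def)

lemma compose_PiE: "f \<in> A \<rightarrow>\<^sub>E B \<Longrightarrow> g \<in> B \<rightarrow>\<^sub>E C \<Longrightarrow> compose A g f \<in> A \<rightarrow>\<^sub>E C"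
  by (auto simp: compose_def)

lemma PiE_eq_iff: "f \<in> A \<rightarrow>\<^sub>E B \<Longrightarrow> g \<in> A \<rightarrow>\<^sub>E C \<Longrightarrow> f = g \<longleftrightarrow> (\<forall>x\<in>A. f x = g x)"
  by (metis PiE_ext PiE_iff extensionalityI)

lemma functor_cat_simps [simp]:
  "Ob (functor_cat C D) = {F. is_functor C D F \<and> extensional_functor C F}"
  "Hom (functor_cat C D) F G = {\<eta>. is_nat_trans C D F G \<eta> \<and> \<eta> \<in> extensional (Ob C)}"
  "Ident (functor_cat C D) F = (\<lambda>a\<in>Ob C. Ident D (FOb F a))"
  "Comp (functor_cat C D) F G H \<theta> \<eta> =
    (\<lambda>a\<in>Ob C. Comp D (FOb F a) (FOb G a) (FOb H a) (\<theta> a) (\<eta> a))"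
  by (simp_all add: functor_cat_def)

lemma is_category_set_cat: "is_category (set_cat \<U>)"
  unfolding is_category_def set_cat_simps
proof (intro conjI ballI)
  fix A B C D :: "'a set" and f g h
  assume "f \<in> A \<rightarrow>\<^sub>E B" "g \<in> B \<rightarrow>\<^sub>E C" "h \<in> C \<rightarrow>\<^sub>E D"
  then show "compose A h (compose A g f) = compose A (compose B h g) f"
    by (intro compose_assoc) (simp add: PiE_def)
qed (auto simp: PiE_def Id_compose intro: compose_Id funcset_compose[THEN funcset_mem])

lemma is_category_op_poset_cat:
  assumes "\<And>a. a \<in> P \<Longrightarrow> le a a"
    and "\<And>a b c. a \<in> P \<Longrightarrow> b \<in> P \<Longrightarrow> c \<in> P \<Longrightarrow> le a b \<Longrightarrow> le b c \<Longrightarrow> le a c"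
  shows "is_category (op_cat (poset_cat P le))"
  unfolding is_category_def using assms(1) by (auto intro: assms(2))

text \<open>Two naturality squares are pasted along the arrow of \<open>G\<close>. The composite
  carries the restriction to \<open>Ob C\<close> because arrows of \<open>functor_cat\<close> are
  extensional.\<close>

lemma is_nat_trans_comp:
  assumes C: "is_category C" and D: "is_category D"
    and F: "is_functor C D F" and G: "is_functor C D G" and H: "is_functor C D H"
    and \<eta>: "is_nat_trans C D F G \<eta>" and \<theta>: "is_nat_trans C D G H \<theta>"
  shows "is_nat_trans C D F H (\<lambda>a\<in>Ob C. Comp D (FOb F a) (FOb G a) (FOb H a) (\<theta> a) (\<eta> a))"
proof -
  note [simp] = category_comp[OF D]
  have ob [simp]: "FOb F a \<in> Ob D" "FOb G a \<in> Ob D" "FOb H a \<in> Ob D" if "a \<in> Ob C" for a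
    using F G H that by (simp_all add: is_functor_def)
  have hom [simp]: "FHom F a b f \<in> Hom D (FOb F a) (FOb F b)"
    "FHom G a b f \<in> Hom D (FOb G a) (FOb G b)" "FHom H a b f \<in> Hom D (FOb H a) (FOb H b)"
    if "a \<in> Ob C" "b \<in> Ob C" "f \<in> Hom C a b" for a b f
    using F G H that by (simp_all add: is_functor_def)
  have tr [simp]: "\<eta> a \<in> Hom D (FOb F a) (FOb G a)" "\<theta> a \<in> Hom D (FOb G a) (FOb H a)"
    if "a \<in> Ob C" for a
    using \<eta> \<theta> that by (simp_all add: is_nat_trans_def)
  have nat: "Comp D (FOb F a) (FOb F b) (FOb G b) (\<eta> b) (FHom F a b f) =
        Comp D (FOb F a) (FOb G a) (FOb G b) (FHom G a b f) (\<eta> a)"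
    "Comp D (FOb G a) (FOb G b) (FOb H b) (\<theta> b) (FHom G a b f) =
        Comp D (FOb G a) (FOb H a) (FOb H b) (FHom H a b f) (\<theta> a)"
    if "a \<in> Ob C" "b \<in> Ob C" "f \<in> Hom C a b" for a b f
    using \<eta> \<theta> that by (simp_all add: is_nat_trans_def)
  show ?thesis
    unfolding is_nat_trans_def
  proof (intro conjI ballI)
    fix a b f assume ab: "a \<in> Ob C" "b \<in> Ob C" "f \<in> Hom C a b"
    have "Comp D (FOb F a) (FOb F b) (FOb H b) (Comp D (FOb F b) (FOb G b) (FOb H b) (\<theta> b) (\<eta> b))
        (FHom F a b f) =
      Comp D (FOb F a) (FOb G b) (FOb H b) (\<theta> b)
        (Comp D (FOb F a) (FOb G a) (FOb G b) (FHom G a b f) (\<eta> a))"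
      using ab by (simp add: category_assoc[OF D] nat)
    also have "\<dots> = Comp D (FOb F a) (FOb G a) (FOb H b)
        (Comp D (FOb G a) (FOb G b) (FOb H b) (\<theta> b) (FHom G a b f)) (\<eta> a)"
      using ab by (simp add: category_assoc[OF D])
    also have "\<dots> = Comp D (FOb F a) (FOb H a) (FOb H b) (FHom H a b f)
        (Comp D (FOb F a) (FOb G a) (FOb H a) (\<theta> a) (\<eta> a))"
      using ab by (simp add: category_assoc[OF D] nat)
    finally show "Comp D (FOb F a) (FOb F b) (FOb H b)
        ((\<lambda>a\<in>Ob C. Comp D (FOb F a) (FOb G a) (FOb H a) (\<theta> a) (\<eta> a)) b) (FHom F a b f) =
      Comp D (FOb F a) (FOb H a) (FOb H b) (FHom H a b f)
        ((\<lambda>a\<in>Ob C. Comp D (FOb F a) (FOb G a) (FOb H a) (\<theta> a) (\<eta> a)) a)"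
      using ab by simp
  qed simp
qed

lemma is_category_functor_cat:
  assumes C: "is_category C" and D: "is_category D"
  shows "is_category (functor_cat C D)"
  unfolding is_category_def
proof (intro conjI ballI)
  fix F assume F: "F \<in> Ob (functor_cat C D)"
  then show "Ident (functor_cat C D) F \<in> Hom (functor_cat C D) F F"
    by (simp add: is_nat_trans_def is_functor_def category_ident[OF D] category_id_left[OF D]
        category_id_right[OF D])
next
  fix F G H \<eta> \<theta>
  assume "F \<in> Ob (functor_cat C D)" "G \<in> Ob (functor_cat C D)" "H \<in> Ob (functor_cat C D)"
    "\<eta> \<in> Hom (functor_cat C D) F G" "\<theta> \<in> Hom (functor_cat C D) G H"
  then show "Comp (functor_cat C D) F G H \<theta> \<eta> \<in> Hom (functor_cat C D) F H"
    by (simp add: is_nat_trans_comp[OF C D])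
next
  fix F G \<eta>
  assume "F \<in> Ob (functor_cat C D)" "G \<in> Ob (functor_cat C D)" "\<eta> \<in> Hom (functor_cat C D) F G"
  then show "Comp (functor_cat C D) F F G \<eta> (Ident (functor_cat C D) F) = \<eta>"
    "Comp (functor_cat C D) F G G (Ident (functor_cat C D) G) \<eta> = \<eta>"
    by (auto simp: is_nat_trans_def is_functor_def category_id_left[OF D] category_id_right[OF D]
        intro: extensionalityI)
next
  fix F G H K \<eta> \<theta> \<kappa>
  assume *: "F \<in> Ob (functor_cat C D)" "G \<in> Ob (functor_cat C D)" "H \<in> Ob (functor_cat C D)"
    "K \<in> Ob (functor_cat C D)" "\<eta> \<in> Hom (functor_cat C D) F G" "\<theta> \<in> Hom (functor_cat C D) G H"
    "\<kappa> \<in> Hom (functor_cat C D) H K"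
  have "FOb F a \<in> Ob D" "FOb G a \<in> Ob D" "FOb H a \<in> Ob D" "FOb K a \<in> Ob D"
    "\<eta> a \<in> Hom D (FOb F a) (FOb G a)" "\<theta> a \<in> Hom D (FOb G a) (FOb H a)"
    "\<kappa> a \<in> Hom D (FOb H a) (FOb K a)" if "a \<in> Ob C" for a
    using * that by (simp_all add: is_nat_trans_def is_functor_def)
  then show "Comp (functor_cat C D) F H K \<kappa> (Comp (functor_cat C D) F G H \<theta> \<eta>) =
    Comp (functor_cat C D) F G K (Comp (functor_cat C D) G H K \<kappa> \<theta>) \<eta>"
    by (simp add: category_assoc[OF D] cong: restrict_cong)
qed

section \<open>Presheaves on families of sets ordered by inclusion, in terms of elements\<close>

abbreviation poset_presheaf :: "'u set set \<Rightarrow> 'a set set \<Rightarrow> ('a set, 'u) presheaf \<Rightarrow> bool" where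
  "poset_presheaf \<U> P \<equiv> is_functor (op_cat (poset_cat P (\<subseteq>))) (set_cat \<U>)"

abbreviation presheaf_trans ::
  "'u set set \<Rightarrow> 'a set set \<Rightarrow> ('a set, 'u) presheaf \<Rightarrow> ('a set, 'u) presheaf \<Rightarrow>
   ('a set \<Rightarrow> 'u \<Rightarrow> 'u) \<Rightarrow> bool" where
  "presheaf_trans \<U> P \<equiv> is_nat_trans (op_cat (poset_cat P (\<subseteq>))) (set_cat \<U>)"

text \<open>Hom-sets of a poset category have the form \<open>{u :: unit. le b a}\<close>; this
  turns quantification over arrows into an implication.\<close>

lemma ball_unit_Collect: "(\<forall>u\<in>{u :: unit. Q}. R u) \<longleftrightarrow> (Q \<longrightarrow> R ())"
  by auto

text \<open>Arrows of \<open>set_cat\<close> are extensional functions, so the functor laws may be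
  tested on elements of \<open>FOb F a\<close>. Later arguments use restriction maps only in this
  form.\<close>

lemma poset_presheaf_iff:
  "poset_presheaf \<U> P F \<longleftrightarrow>
    (\<forall>a\<in>P. FOb F a \<in> \<U>) \<and>
    (\<forall>a\<in>P. \<forall>b\<in>P. b \<subseteq> a \<longrightarrow> restr F a b \<in> FOb F a \<rightarrow>\<^sub>E FOb F b) \<and>
    (\<forall>a\<in>P. \<forall>x\<in>FOb F a. restr F a a x = x) \<and>
    (\<forall>a\<in>P. \<forall>b\<in>P. \<forall>c\<in>P. b \<subseteq> a \<longrightarrow> c \<subseteq> b \<longrightarrow>
      (\<forall>x\<in>FOb F a. restr F b c (restr F a b x) = restr F a c x))"
  (is "?L \<longleftrightarrow> ?O \<and> ?H \<and> ?I \<and> ?C")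
proof -
  have "?L \<longleftrightarrow> ?O \<and> ?H \<and> (\<forall>a\<in>P. restr F a a = (\<lambda>x\<in>FOb F a. x)) \<and>
      (\<forall>a\<in>P. \<forall>b\<in>P. \<forall>c\<in>P. b \<subseteq> a \<longrightarrow> c \<subseteq> b \<longrightarrow>
        restr F a c = compose (FOb F a) (restr F b c) (restr F a b))"
    unfolding is_functor_def op_poset_cat_simps set_cat_simps ball_unit_Collect restr_def ..
  also have "\<dots> \<longleftrightarrow> ?O \<and> ?H \<and> ?I \<and> ?C"
  proof (intro conj_cong refl ball_cong imp_cong)
    fix a assume "?H" "a \<in> P"
    then have "restr F a a \<in> FOb F a \<rightarrow>\<^sub>E FOb F a" by blast
    then show "restr F a a = (\<lambda>x\<in>FOb F a. x) \<longleftrightarrow> (\<forall>x\<in>FOb F a. restr F a a x = x)"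
      by (subst PiE_eq_iff[where C = "FOb F a"]) auto
  next
    fix a b c assume *: "?H" "a \<in> P" "b \<in> P" "c \<in> P" "b \<subseteq> a" "c \<subseteq> b"
    then have "c \<subseteq> a" by blast
    with * have "restr F a b \<in> FOb F a \<rightarrow>\<^sub>E FOb F b" "restr F b c \<in> FOb F b \<rightarrow>\<^sub>E FOb F c"
      and ac: "restr F a c \<in> FOb F a \<rightarrow>\<^sub>E FOb F c"
      by blast+
    then have "compose (FOb F a) (restr F b c) (restr F a b) \<in> FOb F a \<rightarrow>\<^sub>E FOb F c"
      by (intro compose_PiE)
    then show "restr F a c = compose (FOb F a) (restr F b c) (restr F a b) \<longleftrightarrow>
        (\<forall>x\<in>FOb F a. restr F b c (restr F a b x) = restr F a c x)"
      using PiE_eq_iff[OF ac] by (auto simp: compose_eq)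
  qed
  finally show ?thesis .
qed

lemma presheaf_restr_PiE:
  "poset_presheaf \<U> P F \<Longrightarrow> a \<in> P \<Longrightarrow> b \<in> P \<Longrightarrow> b \<subseteq> a \<Longrightarrow> restr F a b \<in> FOb F a \<rightarrow>\<^sub>E FOb F b"
  by (simp add: poset_presheaf_iff)

lemma presheaf_restr_mem:
  "poset_presheaf \<U> P F \<Longrightarrow> a \<in> P \<Longrightarrow> b \<in> P \<Longrightarrow> b \<subseteq> a \<Longrightarrow> x \<in> FOb F a \<Longrightarrow> restr F a b x \<in> FOb F b"
  using presheaf_restr_PiE by (rule PiE_mem)

lemma presheaf_restr_restr:
  "poset_presheaf \<U> P F \<Longrightarrow> a \<in> P \<Longrightarrow> b \<in> P \<Longrightarrow> c \<in> P \<Longrightarrow> b \<subseteq> a \<Longrightarrow> c \<subseteq> b \<Longrightarrow> x \<in> FOb F a \<Longrightarrow>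
   restr F b c (restr F a b x) = restr F a c x"
  by (simp add: poset_presheaf_iff)

lemma presheaf_trans_iff:
  assumes F: "poset_presheaf \<U> P F" and G: "poset_presheaf \<U> P G"
  shows "presheaf_trans \<U> P F G \<eta> \<longleftrightarrow>
    (\<forall>a\<in>P. \<eta> a \<in> FOb F a \<rightarrow>\<^sub>E FOb G a) \<and>
    (\<forall>a\<in>P. \<forall>b\<in>P. b \<subseteq> a \<longrightarrow> (\<forall>x\<in>FOb F a. \<eta> b (restr F a b x) = restr G a b (\<eta> a x)))"
  (is "?L \<longleftrightarrow> ?H \<and> ?N")
proof -
  have "?L \<longleftrightarrow> ?H \<and> (\<forall>a\<in>P. \<forall>b\<in>P. b \<subseteq> a \<longrightarrow>
      compose (FOb F a) (\<eta> b) (restr F a b) = compose (FOb F a) (restr G a b) (\<eta> a))"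
    unfolding is_nat_trans_def op_poset_cat_simps set_cat_simps ball_unit_Collect restr_def ..
  also have "\<dots> \<longleftrightarrow> ?H \<and> ?N"
  proof (intro conj_cong refl ball_cong imp_cong)
    fix a b assume *: "?H" "a \<in> P" "b \<in> P" "b \<subseteq> a"
    have "compose (FOb F a) (\<eta> b) (restr F a b) \<in> FOb F a \<rightarrow>\<^sub>E FOb G b"
      using * presheaf_restr_PiE[OF F] by (intro compose_PiE[where B = "FOb F b"]) auto
    moreover have "compose (FOb F a) (restr G a b) (\<eta> a) \<in> FOb F a \<rightarrow>\<^sub>E FOb G b"
      using * presheaf_restr_PiE[OF G] by (intro compose_PiE[where B = "FOb G a"]) auto
    ultimately show "compose (FOb F a) (\<eta> b) (restr F a b) = compose (FOb F a) (restr G a b) (\<eta> a) \<longleftrightarrow>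
        (\<forall>x\<in>FOb F a. \<eta> b (restr F a b x) = restr G a b (\<eta> a x))"
      by (simp add: PiE_eq_iff compose_eq)
  qed
  finally show ?thesis .
qed

lemma is_category_poset_topos: "is_category (poset_topos \<U> P (\<subseteq>))"
  unfolding poset_topos_def
  by (intro is_category_functor_cat is_category_op_poset_cat is_category_set_cat) auto

text \<open>The componentwise inverses are automatically natural: write \<open>y\<close> as
  \<open>\<eta> a (\<theta> a y)\<close>, move \<open>\<eta>\<close> past the restriction map, and
  cancel with \<open>\<theta> b\<close>.\<close>

lemma presheaf_iso_if_bij:
  assumes F: "poset_presheaf \<U> P F" and G: "poset_presheaf \<U> P G"
    and \<eta>: "presheaf_trans \<U> P F G \<eta>" "\<eta> \<in> extensional P"
    and bij: "\<And>a. a \<in> P \<Longrightarrow> bij_betw (\<eta> a) (FOb F a) (FOb G a)"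
  shows "is_iso (poset_topos \<U> P (\<subseteq>)) F G \<eta>"
proof -
  define \<theta> where "\<theta> = (\<lambda>a\<in>P. \<lambda>y\<in>FOb G a. inv_into (FOb F a) (\<eta> a) y)"
  have \<theta>\<eta>: "\<theta> a (\<eta> a x) = x" if "a \<in> P" "x \<in> FOb F a" for a x
    using bij[OF that(1)] that by (auto simp: \<theta>_def bij_betw_def)
  have \<eta>\<theta>: "\<eta> a (\<theta> a y) = y" and \<theta>_mem: "\<theta> a y \<in> FOb F a" if "a \<in> P" "y \<in> FOb G a" for a y
    using bij[OF that(1)] that
    by (auto simp: \<theta>_def bij_betw_def f_inv_into_f inv_into_into)
  have \<theta>_hom: "\<theta> a \<in> FOb G a \<rightarrow>\<^sub>E FOb F a" if "a \<in> P" for a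
    using that \<theta>_mem by (auto simp: \<theta>_def)
  have \<eta>_hom: "\<eta> a \<in> FOb F a \<rightarrow>\<^sub>E FOb G a" if "a \<in> P" for a
    using that \<eta> F G by (auto simp: presheaf_trans_iff)
  have "presheaf_trans \<U> P G F \<theta>"
    unfolding presheaf_trans_iff[OF G F]
  proof (intro conjI ballI impI)
    fix a b y assume ab: "a \<in> P" "b \<in> P" "b \<subseteq> a" "y \<in> FOb G a"
    have "restr G a b y = \<eta> b (restr F a b (\<theta> a y))"
      using \<eta>(1) ab \<theta>_mem[of a y] \<eta>\<theta>[of a y] by (auto simp: presheaf_trans_iff[OF F G])
    moreover have "restr F a b (\<theta> a y) \<in> FOb F b"
      using ab \<theta>_mem[of a y] by (intro presheaf_restr_mem[OF F]) auto
    ultimately show "\<theta> b (restr G a b y) = restr F a b (\<theta> a y)"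
      using ab by (simp add: \<theta>\<eta>)
  qed (use \<theta>_hom in auto)
  moreover have "compose (FOb F a) (\<theta> a) (\<eta> a) = (\<lambda>x\<in>FOb F a. x)"
    "compose (FOb G a) (\<eta> a) (\<theta> a) = (\<lambda>x\<in>FOb G a. x)" if "a \<in> P" for a
    using that \<theta>\<eta> \<eta>\<theta> by (auto simp: compose_def intro!: restrict_ext)
  moreover have "\<theta> \<in> extensional P"
    by (simp add: \<theta>_def)
  ultimately show ?thesis
    unfolding is_iso_def using \<eta>
    by (intro conjI bexI[of _ \<theta>]) (auto simp: poset_topos_def intro!: restrict_ext)
qed

section \<open>Finite products of small sets\<close>

lemma set_universe_singleton:
  assumes "set_universe \<U>"
  obtains a where "{a} \<in> \<U>"
  using assms unfolding set_universe_def
  by (metis all_not_in_conv empty_subsetI insert_subset)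

text \<open>A product of sets over \<open>'u\<close> has functions as elements, hence smallness only
  up to an injection \<open>e\<close>. In the inductive step a function is split into its value at
  \<open>i\<close> and its restriction to \<open>I\<close>; the pair is coded by the binary product,
  and closure under subsets makes the image small.\<close>

lemma set_universe_PiE:
  assumes \<U>: "set_universe \<U>" and "finite I" "\<And>i. i \<in> I \<Longrightarrow> A i \<in> \<U>"
  shows "\<exists>e. inj_on e (Pi\<^sub>E I A) \<and> e ` Pi\<^sub>E I A \<in> \<U>"
  using assms(2,3)
proof (induction I)
  case empty
  obtain a where "{a} \<in> \<U>"
    using set_universe_singleton[OF \<U>] .
  \<comment> \<open>The empty product has one element, so a constant map is injective on it and has
    image \<open>{a}\<close>.\<close>
  then show ?case
    by (intro exI[of _ "\<lambda>_. a"]) auto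
next
  case (insert i I)
  then obtain e where e: "inj_on e (Pi\<^sub>E I A)" "e ` Pi\<^sub>E I A \<in> \<U>"
    by auto
  moreover have "A i \<in> \<U>"
    using insert by auto
  ultimately obtain C h where C: "C \<in> \<U>" and h: "bij_betw h (A i \<times> e ` Pi\<^sub>E I A) C"
    using \<U> unfolding set_universe_def by meson
  let ?p = "\<lambda>f. (f i, e (restrict f I))"
  have res: "restrict f I \<in> Pi\<^sub>E I A" if "f \<in> Pi\<^sub>E (insert i I) A" for f
    using that by auto
  have "inj_on ?p (Pi\<^sub>E (insert i I) A)"
  proof (intro inj_onI PiE_ext)
    fix f g j assume fg: "f \<in> Pi\<^sub>E (insert i I) A" "g \<in> Pi\<^sub>E (insert i I) A" "?p f = ?p g"
      and j: "j \<in> insert i I"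
    have "restrict f I = restrict g I"
      using fg(3) by (intro inj_onD[OF e(1) _ res[OF fg(1)] res[OF fg(2)]]) simp
    then show "f j = g j"
      using fg(3) j by (metis Pair_inject insertE restrict_apply')
  qed
  moreover have "?p ` Pi\<^sub>E (insert i I) A \<subseteq> A i \<times> e ` Pi\<^sub>E I A"
    using res by auto
  ultimately have "inj_on (h \<circ> ?p) (Pi\<^sub>E (insert i I) A)"
    and "(h \<circ> ?p) ` Pi\<^sub>E (insert i I) A \<subseteq> C"
    using h by (auto simp: bij_betw_def image_subset_iff intro!: comp_inj_on elim: inj_on_subset)
  then show ?case
    using C \<U> unfolding set_universe_def by meson
qed

section \<open>Irreducible open sets of a finite space\<close>

definition irr_below :: "'a topology \<Rightarrow> 'a set \<Rightarrow> 'a set set" where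
  "irr_below X U = {V. irreducible_open X V \<and> V \<subseteq> U}"

lemma irreducible_open_imp_openin: "irreducible_open X V \<Longrightarrow> openin X V"
  by (simp add: irreducible_open_def)

lemma irr_belowD:
  assumes "V \<in> irr_below X U"
  shows "irreducible_open X V" "openin X V" "V \<subseteq> U"
  using assms by (simp_all add: irr_below_def irreducible_open_def)

lemma irr_below_mono: "V \<subseteq> U \<Longrightarrow> irr_below X V \<subseteq> irr_below X U"
  by (auto simp: irr_below_def)

lemma finite_irr_below:
  assumes "finite (topspace X)"
  shows "finite (irr_below X U)"
  using assms by (rule finite_subset[rotated, OF finite_Pow_iff[THEN iffD2]])
    (auto simp: irr_below_def irreducible_open_def dest: openin_subset)

text \<open>Strong induction on \<open>card U\<close>: a non-empty reducible open set is a union of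
  two proper open subsets, both of smaller cardinality. The empty set is the union of the empty
  family.\<close>

lemma Union_irr_below:
  assumes fin: "finite (topspace X)" and "openin X U"
  shows "\<Union>(irr_below X U) = U"
proof
  show "U \<subseteq> \<Union>(irr_below X U)"
    using \<open>openin X U\<close>
  proof (induction "card U" arbitrary: U rule: less_induct)
    case less
    have "finite U"
      using less.prems fin by (meson finite_subset openin_subset)
    show ?case
    proof (cases "irreducible_open X U \<or> U = {}")
      case True
      then show ?thesis by (auto simp: irr_below_def)
    next
      case False
      then obtain V W where VW: "openin X V" "openin X W" "U = V \<union> W" "V \<noteq> U" "W \<noteq> U"
        using less.prems by (auto simp: irreducible_open_def)
      then have "V \<subset> U" "W \<subset> U" by auto
      then have "V \<subseteq> \<Union>(irr_below X V)" "W \<subseteq> \<Union>(irr_below X W)"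
        using less.hyps VW psubset_card_mono[OF \<open>finite U\<close>] by auto
      then show ?thesis
        using VW(3) irr_below_mono[of V U X] irr_below_mono[of W U X] by blast
    qed
  qed
qed (auto simp: irr_below_def)

text \<open>Irreducible elements of a distributive lattice are prime: splitting \<open>T\<close> as
  \<open>(T \<inter> V) \<union> (T \<inter> \<Union>\<V>)\<close> peels one member off the cover.
  The empty cover is excluded because \<open>T\<close> is non-empty.\<close>

lemma irreducible_open_subset_member:
  assumes "finite \<V>" and T: "irreducible_open X T" and "\<And>V. V \<in> \<V> \<Longrightarrow> openin X V" and "T \<subseteq> \<Union>\<V>"
  shows "\<exists>V\<in>\<V>. T \<subseteq> V"
  using assms(1,3,4)
proof (induction \<V>)
  case empty
  then show ?case using T by (simp add: irreducible_open_def)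
next
  case (insert V \<V>)
  have "openin X (T \<inter> V)" "openin X (T \<inter> \<Union>\<V>)"
    using T insert.prems by (auto simp: irreducible_open_def intro!: openin_Int openin_Union)
  moreover have "T = (T \<inter> V) \<union> (T \<inter> \<Union>\<V>)"
    using insert.prems by auto
  ultimately have "T \<inter> V = T \<or> T \<inter> \<Union>\<V> = T"
    using T[unfolded irreducible_open_def] by metis
  then show ?case
  proof
    assume "T \<inter> \<Union>\<V> = T"
    then have "T \<subseteq> \<Union>\<V>" by auto
    then show ?case
      using insert.IH insert.prems(1) by simp
  qed auto
qed

section \<open>Sections of sheaves as matching families\<close>

text \<open>The limit of \<open>P\<close> over \<open>irr_below X U\<close>. It is used both for
  presheaves on the irreducible open sets and for presheaves on all open sets. The extensional
  product makes equality of families a matter of their values on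
  \<open>irr_below X U\<close>.\<close>

definition matching :: "'a topology \<Rightarrow> ('a set, 'u) presheaf \<Rightarrow> 'a set \<Rightarrow> ('a set \<Rightarrow> 'u) set" where
  "matching X P U = {s \<in> Pi\<^sub>E (irr_below X U) (FOb P).
     \<forall>V\<in>irr_below X U. \<forall>W\<in>irr_below X V. restr P V W (s V) = s W}"

lemma matching_mem: "s \<in> matching X P U \<Longrightarrow> V \<in> irr_below X U \<Longrightarrow> s V \<in> FOb P V"
  by (auto simp: matching_def)

lemma matching_restr:
  "s \<in> matching X P U \<Longrightarrow> V \<in> irr_below X U \<Longrightarrow> W \<in> irr_below X V \<Longrightarrow> restr P V W (s V) = s W"
  by (simp add: matching_def)

lemma matching_eqI:
  "s \<in> matching X P U \<Longrightarrow> t \<in> matching X P U \<Longrightarrow> (\<And>V. V \<in> irr_below X U \<Longrightarrow> s V = t V) \<Longrightarrow> s = t"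
  by (auto simp: matching_def intro: PiE_ext)

lemma matching_restrict:
  assumes "s \<in> matching X P U" "V \<subseteq> U"
  shows "restrict s (irr_below X V) \<in> matching X P V"
proof -
  have sub: "irr_below X W \<subseteq> irr_below X V" if "W \<in> irr_below X V" for W
    by (rule irr_below_mono) (rule irr_belowD(3)[OF that])
  have "W \<in> irr_below X U" if "W \<in> irr_below X V" for W
    using that irr_below_mono[OF assms(2)] by blast
  then show ?thesis
    using matching_mem[OF assms(1)] matching_restr[OF assms(1)] subsetD[OF sub]
    by (simp add: matching_def)
qed

text \<open>The sheaf axiom for two irreducible members \<open>V\<close>, \<open>W\<close> of the cover concerns \<open>V \<inter> W\<close>, which need not be
  irreducible; agreement there is checked on the irreducible open subsets of \<open>V \<inter> W\<close>.\<close>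

lemma sheaf_eqI:
  assumes fin: "finite (topspace X)" and F: "poset_presheaf \<U> {U. openin X U} F" and sh: "is_sheaf X F"
    and U: "openin X U" and x: "x \<in> FOb F U" and y: "y \<in> FOb F U"
    and eq: "\<And>V. V \<in> irr_below X U \<Longrightarrow> restr F U V x = restr F U V y"
  shows "x = y"
proof -
  \<comment> \<open>Both \<open>x\<close> and \<open>y\<close> glue the family of restrictions of
    \<open>x\<close> to the cover \<open>irr_below X U\<close>, so the uniqueness half of the sheaf
    axiom identifies them.\<close>
  have "\<exists>!t. t \<in> FOb F (\<Union>(irr_below X U)) \<and>
      (\<forall>V\<in>irr_below X U. restr F (\<Union>(irr_below X U)) V t = restr F U V x)"
  proof (rule sh[unfolded is_sheaf_def, rule_format])
    fix V W assume VW: "V \<in> irr_below X U" "W \<in> irr_below X U"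
    note irr_belowD[OF VW(1)] irr_belowD[OF VW(2)]
    then show "restr F V (V \<inter> W) (restr F U V x) = restr F W (V \<inter> W) (restr F U W x)"
      using F U x by (simp add: poset_presheaf_iff openin_Int)
  qed (use U x in \<open>auto dest: irr_belowD intro!: presheaf_restr_mem[OF F]\<close>)
  then show ?thesis
    using x y eq unfolding Union_irr_below[OF fin U] by metis
qed

text \<open>Together with \<open>sheaf_eqI\<close> this identifies \<open>FOb F U\<close> with the
  limit \<open>matching X F U\<close>. A matching family is compatible only along nested irreducible
  sets, which has to be upgraded to compatibility on intersections.\<close>

lemma sheaf_glue:
  assumes fin: "finite (topspace X)" and F: "poset_presheaf \<U> {U. openin X U} F" and sh: "is_sheaf X F"
    and U: "openin X U" and s: "s \<in> matching X F U"
  obtains t where "t \<in> FOb F U" "\<And>V. V \<in> irr_below X U \<Longrightarrow> restr F U V t = s V"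
proof -
  have "\<exists>!t. t \<in> FOb F (\<Union>(irr_below X U)) \<and>
      (\<forall>V\<in>irr_below X U. restr F (\<Union>(irr_below X U)) V t = s V)"
  proof (rule sh[unfolded is_sheaf_def, rule_format])
    fix V W assume VW: "V \<in> irr_below X U" "W \<in> irr_below X U"
    note V = irr_belowD[OF VW(1)] and W = irr_belowD[OF VW(2)]
    have VW_open: "openin X (V \<inter> W)"
      using V W by (simp add: openin_Int)
    show "restr F V (V \<inter> W) (s V) = restr F W (V \<inter> W) (s W)"
    proof (rule sheaf_eqI[OF fin F sh VW_open])
      fix T assume T: "T \<in> irr_below X (V \<inter> W)"
      then have "T \<in> irr_below X V" "T \<in> irr_below X W"
        by (auto simp: irr_below_def)
      moreover have "restr F (V \<inter> W) T (restr F V (V \<inter> W) (s V)) = restr F V T (s V)"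
        "restr F (V \<inter> W) T (restr F W (V \<inter> W) (s W)) = restr F W T (s W)"
        using F V W VW_open irr_belowD[OF T] matching_mem[OF s VW(1)] matching_mem[OF s VW(2)]
        by (simp_all add: poset_presheaf_iff)
      ultimately show "restr F (V \<inter> W) T (restr F V (V \<inter> W) (s V)) =
          restr F (V \<inter> W) T (restr F W (V \<inter> W) (s W))"
        using matching_restr[OF s VW(1)] matching_restr[OF s VW(2)] by simp
    qed (use V W VW_open matching_mem[OF s VW(1)] matching_mem[OF s VW(2)] in
        \<open>auto intro!: presheaf_restr_mem[OF F]\<close>)
  qed (use s in \<open>auto simp: matching_mem dest: irr_belowD\<close>)
  then show ?thesis
    using that unfolding Union_irr_below[OF fin U] by metis
qed

section \<open>Restriction to the irreducible open sets\<close>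

text \<open>The explicit \<open>undefined\<close> values make the result extensional, as objects of
  \<open>functor_cat\<close> must be.\<close>

definition restrict_presheaf :: "'a set set \<Rightarrow> ('a set, 'u) presheaf \<Rightarrow> ('a set, 'u) presheaf" where
  "restrict_presheaf Q F =
     \<lparr>FOb = (\<lambda>a. if a \<in> Q then FOb F a else undefined),
      FHom = (\<lambda>a b f. if a \<in> Q \<and> b \<in> Q \<and> b \<subseteq> a then FHom F a b f else undefined)\<rparr>"

definition restriction_functor ::
  "'a set set \<Rightarrow> (('a set, 'u) presheaf, 'a set \<Rightarrow> 'u \<Rightarrow> 'u, ('a set, 'u) presheaf,
    'a set \<Rightarrow> 'u \<Rightarrow> 'u) cfunctor" where
  "restriction_functor Q = \<lparr>FOb = restrict_presheaf Q, FHom = (\<lambda>F G \<eta>. restrict \<eta> Q)\<rparr>"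

lemma restrict_presheaf_simps [simp]:
  "a \<in> Q \<Longrightarrow> FOb (restrict_presheaf Q F) a = FOb F a"
  "a \<in> Q \<Longrightarrow> b \<in> Q \<Longrightarrow> b \<subseteq> a \<Longrightarrow> restr (restrict_presheaf Q F) a b = restr F a b"
  by (simp_all add: restrict_presheaf_def restr_def)

lemma poset_presheaf_restrict:
  assumes "poset_presheaf \<U> P F" "Q \<subseteq> P"
  shows "poset_presheaf \<U> Q (restrict_presheaf Q F)"
  using assms(1) subsetD[OF assms(2)] unfolding poset_presheaf_iff by (simp add: subset_trans)

lemma extensional_restrict_presheaf:
  "extensional_functor (op_cat (poset_cat Q (\<subseteq>))) (restrict_presheaf Q F)"
  by (auto simp: extensional_functor_def restrict_presheaf_def)

text \<open>A full subcategory inherits all arrows, so an arbitrary predicate \<open>S\<close> can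
  stand for the sheaf condition.\<close>

lemma is_functor_restriction:
  assumes QP: "Q \<subseteq> P"
  shows "is_functor (full_subcat (poset_topos \<U> P (\<subseteq>)) S) (poset_topos \<U> Q (\<subseteq>)) (restriction_functor Q)"
proof -
  have "presheaf_trans \<U> Q (restrict_presheaf Q F) (restrict_presheaf Q G) (restrict \<eta> Q)"
    if "poset_presheaf \<U> P F" "poset_presheaf \<U> P G" "presheaf_trans \<U> P F G \<eta>" for F G \<eta>
    using that(3) subsetD[OF QP] unfolding presheaf_trans_iff[OF that(1,2)]
      presheaf_trans_iff[OF that(1,2)[THEN poset_presheaf_restrict[OF _ QP]]]
    by simp
  \<comment> \<open>Identities and composites on \<open>P\<close> are themselves cut off outside
    \<open>P\<close>; cutting off again at \<open>Q\<close> gives those on \<open>Q\<close>.\<close>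
  moreover have "(\<lambda>a\<in>Q. (\<lambda>a\<in>P. h a) a) = (\<lambda>a\<in>Q. h a)" for h :: "'a set \<Rightarrow> 'b \<Rightarrow> 'b"
    using QP by (auto intro!: restrict_ext)
  ultimately show ?thesis
    unfolding is_functor_def[of "full_subcat _ _"]
    by (auto simp: poset_topos_def restriction_functor_def poset_presheaf_restrict[OF _ QP]
        extensional_restrict_presheaf cong: restrict_cong)
qed

text \<open>All separating and gluing happens in the target: sections of \<open>G\<close> are
  determined by, and can be assembled from, their restrictions to irreducible open sets. Hence
  \<open>G\<close> is a sheaf while \<open>F\<close> is any presheaf on the open sets.\<close>

lemma restriction_fully_faithful:
  assumes fin: "finite (topspace X)"
    and F: "poset_presheaf \<U> {U. openin X U} F" and G: "poset_presheaf \<U> {U. openin X U} G"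
    and sh: "is_sheaf X G"
  defines "Q \<equiv> {U. irreducible_open X U}"
  shows "bij_betw (\<lambda>\<eta>. restrict \<eta> Q)
    {\<eta>. presheaf_trans \<U> {U. openin X U} F G \<eta> \<and> \<eta> \<in> extensional {U. openin X U}}
    {\<theta>. presheaf_trans \<U> Q (restrict_presheaf Q F) (restrict_presheaf Q G) \<theta> \<and> \<theta> \<in> extensional Q}"
    (is "bij_betw _ ?T ?S")
proof -
  let ?O = "{U. openin X U}"
  have QO: "Q \<subseteq> ?O"
    by (auto simp: Q_def irreducible_open_imp_openin)
  have FQ: "poset_presheaf \<U> Q (restrict_presheaf Q F)" and GQ: "poset_presheaf \<U> Q (restrict_presheaf Q G)"
    using F G QO by (simp_all add: poset_presheaf_restrict)
  have irr: "V \<in> Q" "V \<in> ?O" "V \<subseteq> U" if "V \<in> irr_below X U" for U V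
    using irr_belowD[OF that] by (simp_all add: Q_def)
  have T_hom: "\<eta> U \<in> FOb F U \<rightarrow>\<^sub>E FOb G U" if "\<eta> \<in> ?T" "U \<in> ?O" for \<eta> U
    using that by (simp add: presheaf_trans_iff[OF F G])
  have T_nat: "\<eta> V (restr F U V x) = restr G U V (\<eta> U x)"
    if "\<eta> \<in> ?T" "U \<in> ?O" "V \<in> ?O" "V \<subseteq> U" "x \<in> FOb F U" for \<eta> U V x
    using that by (simp add: presheaf_trans_iff[OF F G])
  have "inj_on (\<lambda>\<eta>. restrict \<eta> Q) ?T"
  proof (rule inj_onI)
    fix \<eta> \<eta>' assume \<eta>: "\<eta> \<in> ?T" "\<eta>' \<in> ?T" and eq: "restrict \<eta> Q = restrict \<eta>' Q"
    have "\<eta> U = \<eta>' U" if U: "U \<in> ?O" for U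
    proof (rule PiE_ext[OF T_hom[OF \<eta>(1) U] T_hom[OF \<eta>(2) U]])
      fix x assume x: "x \<in> FOb F U"
      show "\<eta> U x = \<eta>' U x"
      proof (rule sheaf_eqI[OF fin G sh])
        fix V assume "V \<in> irr_below X U"
        note V = irr[OF this]
        then have "\<eta> V = \<eta>' V"
          using fun_cong[OF eq, of V] by simp
        then show "restr G U V (\<eta> U x) = restr G U V (\<eta>' U x)"
          using T_nat[OF \<eta>(1) U V(2,3) x] T_nat[OF \<eta>(2) U V(2,3) x] by simp
      qed (use U x T_hom[OF \<eta>(1) U] T_hom[OF \<eta>(2) U] in auto)
    qed
    then show "\<eta> = \<eta>'"
      using \<eta> by (auto intro: extensionalityI)
  qed
  moreover have "restrict \<eta> Q \<in> ?S" if "\<eta> \<in> ?T" for \<eta>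
    using that subsetD[OF QO] by (simp add: presheaf_trans_iff[OF F G] presheaf_trans_iff[OF FQ GQ])
  moreover have "\<theta> \<in> (\<lambda>\<eta>. restrict \<eta> Q) ` ?T" if \<theta>: "\<theta> \<in> ?S" for \<theta>
  proof -
    have \<theta>_hom: "\<theta> V \<in> FOb F V \<rightarrow>\<^sub>E FOb G V" if "V \<in> Q" for V
      using \<theta> that by (simp add: presheaf_trans_iff[OF FQ GQ])
    have \<theta>_nat: "\<theta> W (restr F V W x) = restr G V W (\<theta> V x)"
      if "V \<in> Q" "W \<in> Q" "W \<subseteq> V" "x \<in> FOb F V" for V W x
      using \<theta> that by (simp add: presheaf_trans_iff[OF FQ GQ])
    \<comment> \<open>The extension of \<open>\<theta>\<close> sends \<open>x\<close> to the section
      of \<open>G\<close> glued from the images of the restrictions of \<open>x\<close>.\<close>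
    have "\<exists>t. t \<in> FOb G U \<and> (\<forall>V\<in>irr_below X U. restr G U V t = \<theta> V (restr F U V x))"
      if U: "U \<in> ?O" and x: "x \<in> FOb F U" for U x
    proof -
      have Fx: "restr F U V x \<in> FOb F V" if "V \<in> irr_below X U" for V
        using presheaf_restr_mem[OF F U _ _ x] irr[OF that] by simp
      have "(\<lambda>V\<in>irr_below X U. \<theta> V (restr F U V x)) \<in> matching X G U"
        unfolding matching_def
      proof (intro CollectI conjI ballI)
        fix V W assume V: "V \<in> irr_below X U" and W: "W \<in> irr_below X V"
        have WU: "W \<in> irr_below X U"
          using W irr_below_mono[OF irr(3)[OF V]] by blast
        have "restr G V W (\<theta> V (restr F U V x)) = \<theta> W (restr F V W (restr F U V x))"
          using \<theta>_nat[of V W] irr[OF V] irr[OF W] Fx[OF V] by simp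
        also have "restr F V W (restr F U V x) = restr F U W x"
          using presheaf_restr_restr[OF F U _ _ _ _ x] irr[OF V] irr[OF W] by simp
        finally show "restr G V W ((\<lambda>V\<in>irr_below X U. \<theta> V (restr F U V x)) V) =
            (\<lambda>V\<in>irr_below X U. \<theta> V (restr F U V x)) W"
          using V WU by simp
      qed (use Fx \<theta>_hom irr in \<open>auto dest: PiE_mem\<close>)
      with U obtain y where "y \<in> FOb G U"
        "\<And>V. V \<in> irr_below X U \<Longrightarrow> restr G U V y = (\<lambda>V\<in>irr_below X U. \<theta> V (restr F U V x)) V"
        using sheaf_glue[OF fin G sh] by blast
      then show ?thesis by auto
    qed
    then obtain t where t: "t U x \<in> FOb G U"
      and t_restr: "V \<in> irr_below X U \<Longrightarrow> restr G U V (t U x) = \<theta> V (restr F U V x)"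
      if "U \<in> ?O" "x \<in> FOb F U" for U x V
      by metis
    define \<eta> where "\<eta> = (\<lambda>U\<in>?O. \<lambda>x\<in>FOb F U. t U x)"
    have "\<eta> \<in> ?T"
      unfolding mem_Collect_eq presheaf_trans_iff[OF F G]
    proof (intro conjI ballI impI)
      fix U W x assume UW: "U \<in> ?O" "W \<in> ?O" "W \<subseteq> U" and x: "x \<in> FOb F U"
      have Fx: "restr F U W x \<in> FOb F W"
        using presheaf_restr_mem[OF F UW x] .
      \<comment> \<open>Naturality follows from separatedness: over each irreducible
        \<open>V \<subseteq> W\<close> both sides restrict to
        \<open>\<theta> V (restr F U V x)\<close>.\<close>
      have "t W (restr F U W x) = restr G U W (t U x)"
      proof (rule sheaf_eqI[OF fin G sh])
        fix V assume V: "V \<in> irr_below X W"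
        then have VU: "V \<in> irr_below X U"
          using irr_below_mono[OF UW(3)] by blast
        have "restr G W V (t W (restr F U W x)) = \<theta> V (restr F U V x)"
          using t_restr[OF UW(2) Fx V] presheaf_restr_restr[OF F UW(1,2) _ UW(3) _ x] irr[OF V] by simp
        also have "\<dots> = restr G W V (restr G U W (t U x))"
          using t_restr[OF UW(1) x VU] presheaf_restr_restr[OF G UW(1,2) _ UW(3) _ t[OF UW(1) x]] irr[OF V]
          by simp
        finally show "restr G W V (t W (restr F U W x)) = restr G W V (restr G U W (t U x))" .
      qed (use UW t[OF UW(2) Fx] presheaf_restr_mem[OF G UW t[OF UW(1) x]] in auto)
      then show "\<eta> W (restr F U W x) = restr G U W (\<eta> U x)"
        using UW x Fx by (simp add: \<eta>_def)
    qed (use t in \<open>auto simp: \<eta>_def\<close>)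
    moreover have "\<theta> = restrict \<eta> Q"
    proof (rule extensionalityI)
      fix V assume V: "V \<in> Q"
      then have VO: "V \<in> ?O" and VV: "V \<in> irr_below X V"
        using QO by (auto simp: Q_def irr_below_def)
      have "\<theta> V = \<eta> V"
      proof (rule PiE_ext[OF \<theta>_hom[OF V]])
        show "\<eta> V \<in> FOb F V \<rightarrow>\<^sub>E FOb G V"
          using t VO by (auto simp: \<eta>_def)
        fix x assume x: "x \<in> FOb F V"
        have "restr G V V (t V x) = t V x" "restr F V V x = x"
          using F G VO x t[OF VO x] by (simp_all add: poset_presheaf_iff)
        then show "\<theta> V x = \<eta> V x"
          using t_restr[OF VO x VV] VO x by (simp add: \<eta>_def)
      qed
      then show "\<theta> V = restrict \<eta> Q V"
        using V by simp
    qed (use \<theta> in auto)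
    ultimately show ?thesis by blast
  qed
  ultimately show ?thesis
    unfolding bij_betw_def by blast
qed

section \<open>The sheaf of matching families\<close>

text \<open>The elements of the small sets are of type \<open>'u\<close>, so matching families are represented through
  injections \<open>e U\<close> into \<open>'u\<close>.\<close>

definition matching_sheaf ::
  "'a topology \<Rightarrow> ('a set, 'u) presheaf \<Rightarrow> ('a set \<Rightarrow> ('a set \<Rightarrow> 'u) \<Rightarrow> 'u) \<Rightarrow> ('a set, 'u) presheaf" where
  "matching_sheaf X P e =
     \<lparr>FOb = (\<lambda>U. if openin X U then e U ` matching X P U else undefined),
      FHom = (\<lambda>U V f. if openin X U \<and> openin X V \<and> V \<subseteq> U then
        (\<lambda>x\<in>e U ` matching X P U.
          e V (restrict (inv_into (matching X P U) (e U) x) (irr_below X V))) else undefined)\<rparr>"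

lemma FOb_matching_sheaf: "openin X U \<Longrightarrow> FOb (matching_sheaf X P e) U = e U ` matching X P U"
  by (simp add: matching_sheaf_def)

lemma restr_matching_sheaf:
  assumes "\<And>U. inj_on (e U) (matching X P U)"
    and "openin X U" "openin X V" "V \<subseteq> U" "s \<in> matching X P U"
  shows "restr (matching_sheaf X P e) U V (e U s) = e V (restrict s (irr_below X V))"
  using assms by (simp add: restr_def matching_sheaf_def)

lemma presheaf_matching_sheaf:
  assumes inj: "\<And>U. inj_on (e U) (matching X P U)" and small: "\<And>U. e U ` matching X P U \<in> \<U>"
  shows "poset_presheaf \<U> {U. openin X U} (matching_sheaf X P e)"
proof -
  have "restr (matching_sheaf X P e) U V \<in> e U ` matching X P U \<rightarrow>\<^sub>E e V ` matching X P V"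
    if UV: "openin X U" "openin X V" "V \<subseteq> U" for U V
  proof (rule PiE_I)
    fix x assume "x \<in> e U ` matching X P U"
    then show "restr (matching_sheaf X P e) U V x \<in> e V ` matching X P V"
      using restr_matching_sheaf[OF inj UV] matching_restrict[OF _ UV(3)] by fastforce
  qed (use UV in \<open>simp add: restr_def matching_sheaf_def\<close>)
  \<comment> \<open>This gives the identity law; the intersection of index sets in the next claim
    gives the composition law.\<close>
  moreover have "restrict s (irr_below X U) = s" if "s \<in> matching X P U" for U s
    using that by (auto simp: matching_def)
  moreover have "irr_below X V \<inter> irr_below X W = irr_below X W" if "W \<subseteq> V" for V W
    using irr_below_mono[OF that] by blast
  ultimately show ?thesis
    unfolding poset_presheaf_iff using small
    by (auto simp: FOb_matching_sheaf restr_matching_sheaf[OF inj] matching_restrict)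
qed

lemma extensional_matching_sheaf:
  "extensional_functor (op_cat (poset_cat {U. openin X U} (\<subseteq>))) (matching_sheaf X P e)"
  by (auto simp: extensional_functor_def matching_sheaf_def)

text \<open>Each irreducible \<open>T\<close> below the union lies below some cover member
  \<open>c T\<close>, so the glued family must take the value \<open>m (c T) T\<close> at
  \<open>T\<close>. Compatibility makes this value independent of the choice of
  \<open>c T\<close>.\<close>

lemma is_sheaf_matching_sheaf:
  fixes X :: "'a topology"
  assumes fin: "finite (topspace X)" and inj: "\<And>U. inj_on (e U) (matching X P U)"
  shows "is_sheaf X (matching_sheaf X P e)"
  unfolding is_sheaf_def
proof (intro allI impI)
  fix \<V> :: "'a set set" and s
  let ?F = "matching_sheaf X P e" and ?U = "\<Union>\<V>"
  assume \<V>: "\<forall>V\<in>\<V>. openin X V" and s: "\<forall>V\<in>\<V>. s V \<in> FOb ?F V"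
    and compat: "\<forall>V\<in>\<V>. \<forall>W\<in>\<V>. restr ?F V (V \<inter> W) (s V) = restr ?F W (V \<inter> W) (s W)"
  have U: "openin X ?U"
    using \<V> by blast
  have "finite \<V>"
    using \<V> fin by (intro finite_subset[of \<V> "Pow (topspace X)"]) (auto dest: openin_subset)
  have "\<forall>V\<in>\<V>. \<exists>m. m \<in> matching X P V \<and> s V = e V m"
    using s \<V> by (auto simp: FOb_matching_sheaf)
  then obtain m where m: "\<And>V. V \<in> \<V> \<Longrightarrow> m V \<in> matching X P V" and sm: "\<And>V. V \<in> \<V> \<Longrightarrow> s V = e V (m V)"
    by metis
  \<comment> \<open>Compatibility is given for coded families over \<open>V \<inter> W\<close>;
    injectivity of \<open>e (V \<inter> W)\<close> decodes it, and \<open>T\<close> is one of the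
    indices below \<open>V \<inter> W\<close>.\<close>
  have m_eq: "m V T = m W T" if VW: "V \<in> \<V>" "W \<in> \<V>" and T: "T \<in> irr_below X V" "T \<in> irr_below X W" for V W T
  proof -
    have "openin X V" "openin X W" "openin X (V \<inter> W)"
      using \<V> VW by auto
    then have "restr ?F V (V \<inter> W) (s V) = e (V \<inter> W) (restrict (m V) (irr_below X (V \<inter> W)))"
      "restr ?F W (V \<inter> W) (s W) = e (V \<inter> W) (restrict (m W) (irr_below X (V \<inter> W)))"
      using VW by (simp_all add: sm m restr_matching_sheaf[OF inj])
    then have "e (V \<inter> W) (restrict (m V) (irr_below X (V \<inter> W))) =
        e (V \<inter> W) (restrict (m W) (irr_below X (V \<inter> W)))"
      using compat VW by metis
    then have "restrict (m V) (irr_below X (V \<inter> W)) = restrict (m W) (irr_below X (V \<inter> W))"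
      using m VW by (intro inj_onD[OF inj]) (auto intro!: matching_restrict)
    moreover have "T \<in> irr_below X (V \<inter> W)"
      using T by (auto simp: irr_below_def)
    ultimately show ?thesis
      by (metis restrict_apply')
  qed
  have "\<forall>T\<in>irr_below X ?U. \<exists>V\<in>\<V>. T \<in> irr_below X V"
    using irreducible_open_subset_member[OF \<open>finite \<V>\<close>] \<V> by (auto simp: irr_below_def)
  then obtain c where c: "\<And>T. T \<in> irr_below X ?U \<Longrightarrow> c T \<in> \<V> \<and> T \<in> irr_below X (c T)"
    by metis
  have below_U: "T \<in> irr_below X ?U" if "V \<in> \<V>" "T \<in> irr_below X V" for V T
    using that by (auto simp: irr_below_def)
  define t where "t = (\<lambda>T\<in>irr_below X ?U. m (c T) T)"
  have t_eq: "t T = m V T" if "V \<in> \<V>" "T \<in> irr_below X V" for V T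
    using below_U[OF that] m_eq[OF _ that(1) _ that(2)] c[OF below_U[OF that]] by (simp add: t_def)
  have t: "t \<in> matching X P ?U"
    unfolding matching_def
  proof (intro CollectI conjI ballI)
    show "t \<in> Pi\<^sub>E (irr_below X ?U) (FOb P)"
      using c m by (auto simp: t_def intro: matching_mem)
    fix V W assume V: "V \<in> irr_below X ?U" and W: "W \<in> irr_below X V"
    \<comment> \<open>The member \<open>c V\<close> chosen for \<open>V\<close> also serves for
      \<open>W\<close>, so both values of \<open>t\<close> come from the single matching family
      \<open>m (c V)\<close>.\<close>
    have "W \<in> irr_below X (c V)"
      using W irr_below_mono[OF irr_belowD(3)] c[OF V] by blast
    then show "restr P V W (t V) = t W"
      using t_eq c[OF V] W matching_restr[OF m] by metis
  qed
  show "\<exists>!t. t \<in> FOb ?F ?U \<and> (\<forall>V\<in>\<V>. restr ?F ?U V t = s V)"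
  proof (rule ex1I[of _ "e ?U t"], intro conjI ballI)
    show "e ?U t \<in> FOb ?F ?U"
      using t U by (simp add: FOb_matching_sheaf)
    fix V assume V: "V \<in> \<V>"
    have "restrict t (irr_below X V) = m V"
      using V t m[OF V] t_eq[OF V]
      by (intro matching_eqI[of _ X P V] matching_restrict[OF t]) auto
    then show "restr ?F ?U V (e ?U t) = s V"
      using V U \<V> t by (simp add: restr_matching_sheaf[OF inj] Union_upper sm)
  next
    fix x assume x: "x \<in> FOb ?F ?U \<and> (\<forall>V\<in>\<V>. restr ?F ?U V x = s V)"
    then obtain t' where t': "t' \<in> matching X P ?U" and x_eq: "x = e ?U t'"
      using U by (auto simp: FOb_matching_sheaf)
    have "t' = t"
    proof (rule matching_eqI[OF t' t])
      fix T assume T: "T \<in> irr_below X ?U"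
      have V: "c T \<in> \<V>" "T \<in> irr_below X (c T)" "c T \<subseteq> ?U"
        using c[OF T] by auto
      have "e (c T) (restrict t' (irr_below X (c T))) = e (c T) (m (c T))"
        using x V U \<V> t' by (metis restr_matching_sheaf[OF inj] sm x_eq)
      then have "restrict t' (irr_below X (c T)) = m (c T)"
        by (intro inj_onD[OF inj _ matching_restrict[OF t' V(3)] m[OF V(1)]])
      then show "t' T = t T"
        using V t_eq by (metis restrict_apply')
    qed
    then show "x = e ?U t"
      by (simp add: x_eq)
  qed
qed

text \<open>A matching family over an irreducible \<open>V\<close> is determined by its value at \<open>V\<close>, the largest member of
  \<open>irr_below X V\<close>.\<close>

lemma matching_sheaf_restrict_iso:
  fixes X :: "'a topology"
  defines "Q \<equiv> {U. irreducible_open X U}"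
  assumes P: "poset_presheaf \<U> Q P" and inj: "\<And>U. inj_on (e U) (matching X P U)"
    and small: "\<And>U. e U ` matching X P U \<in> \<U>"
  shows "\<exists>\<eta>. is_iso (poset_topos \<U> Q (\<subseteq>)) (restrict_presheaf Q (matching_sheaf X P e)) P \<eta>"
proof -
  let ?F = "restrict_presheaf Q (matching_sheaf X P e)"
  have Q_open: "openin X V" if "V \<in> Q" for V
    using that by (simp add: Q_def irreducible_open_imp_openin)
  have F: "poset_presheaf \<U> Q ?F"
    using presheaf_matching_sheaf[OF inj small] by (rule poset_presheaf_restrict) (auto simp: Q_open)
  have FOb_F: "FOb ?F V = e V ` matching X P V" if "V \<in> Q" for V
    using that Q_open by (simp add: FOb_matching_sheaf)
  have restr_F: "restr ?F V W (e V s) = e W (restrict s (irr_below X W))"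
    if "V \<in> Q" "W \<in> Q" "W \<subseteq> V" "s \<in> matching X P V" for V W s
    using that Q_open by (simp add: restr_matching_sheaf[OF inj])
  have self: "V \<in> irr_below X V" if "V \<in> Q" for V
    using that by (simp add: Q_def irr_below_def)
  have below: "W \<in> irr_below X V" if "W \<in> Q" "W \<subseteq> V" for V W
    using that by (simp add: Q_def irr_below_def)
  have belowD: "W \<in> Q" "W \<subseteq> V" if "W \<in> irr_below X V" for V W
    using irr_belowD[OF that] by (simp_all add: Q_def)
  \<comment> \<open>Decode the family and evaluate it at \<open>V\<close>.\<close>
  define \<eta> where "\<eta> = (\<lambda>V\<in>Q. \<lambda>x\<in>e V ` matching X P V. inv_into (matching X P V) (e V) x V)"
  have \<eta>: "\<eta> V (e V s) = s V" if "V \<in> Q" "s \<in> matching X P V" for V s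
    using that inj[of V] by (simp add: \<eta>_def)
  have "presheaf_trans \<U> Q ?F P \<eta>"
    unfolding presheaf_trans_iff[OF F P]
  proof (intro conjI ballI impI)
    fix V assume V: "V \<in> Q"
    show "\<eta> V \<in> FOb ?F V \<rightarrow>\<^sub>E FOb P V"
    proof (rule PiE_I)
      fix x assume "x \<in> FOb ?F V"
      then show "\<eta> V x \<in> FOb P V"
        unfolding FOb_F[OF V] using V matching_mem[OF _ self[OF V]] by (auto simp: \<eta>)
    qed (use V in \<open>simp add: FOb_F[OF V] \<eta>_def\<close>)
  next
    fix V W x assume VW: "V \<in> Q" "W \<in> Q" "W \<subseteq> V" and "x \<in> FOb ?F V"
    then obtain s where s: "s \<in> matching X P V" and x: "x = e V s"
      unfolding FOb_F[OF VW(1)] by auto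
    \<comment> \<open>Both sides equal \<open>s W\<close>, by matching from \<open>V\<close> down to
      \<open>W\<close>. The simplification rules for \<open>restrict_presheaf\<close> are switched
      off so that \<open>restr_F\<close> can fire.\<close>
    show "\<eta> W (restr ?F V W x) = restr P V W (\<eta> V x)"
      using VW s matching_restr[OF s self below] self matching_restrict[OF s VW(3)]
      by (simp add: x restr_F \<eta> del: restrict_presheaf_simps)
  qed
  moreover have "bij_betw (\<eta> V) (FOb ?F V) (FOb P V)" if V: "V \<in> Q" for V
    unfolding bij_betw_def FOb_F[OF V]
  proof (intro conjI inj_onI equalityI subsetI)
    fix x y assume "x \<in> e V ` matching X P V" "y \<in> e V ` matching X P V" and eq: "\<eta> V x = \<eta> V y"
    then obtain s t where s: "s \<in> matching X P V" "x = e V s" and t: "t \<in> matching X P V" "y = e V t"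
      by auto
    then have "s V = t V"
      using eq V by (simp add: \<eta>)
    then have "s = t"
      using matching_restr[OF s(1) self[OF V]] matching_restr[OF t(1) self[OF V]]
      by (intro matching_eqI[OF s(1) t(1)]) metis
    then show "x = y"
      using s t by simp
  next
    fix y assume "y \<in> \<eta> V ` e V ` matching X P V"
    then show "y \<in> FOb P V"
      using V matching_mem[OF _ self[OF V]] by (auto simp: \<eta>)
  next
    fix y assume y: "y \<in> FOb P V"
    \<comment> \<open>The preimage of \<open>y\<close> is the family of all its
      restrictions.\<close>
    let ?s = "\<lambda>W\<in>irr_below X V. restr P V W y"
    have s: "?s \<in> matching X P V"
      unfolding matching_def
    proof (intro CollectI conjI ballI)
      show "?s \<in> Pi\<^sub>E (irr_below X V) (FOb P)"
        using presheaf_restr_mem[OF P V _ _ y] belowD by auto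
      fix W T assume W: "W \<in> irr_below X V" and T: "T \<in> irr_below X W"
      then have "T \<in> irr_below X V"
        using irr_below_mono[OF irr_belowD(3)] by blast
      then show "restr P W T (?s W) = ?s T"
        using presheaf_restr_restr[OF P V _ _ _ _ y] belowD[OF W] belowD[OF T] W by simp
    qed
    have "\<eta> V (e V ?s) = y"
      using \<eta>[OF V s] self[OF V] P V y by (simp add: poset_presheaf_iff)
    then show "y \<in> \<eta> V ` e V ` matching X P V"
      using s by (metis imageI)
  qed
  moreover have "\<eta> \<in> extensional Q"
    by (simp add: \<eta>_def)
  ultimately have "is_iso (poset_topos \<U> Q (\<subseteq>)) ?F P \<eta>"
    by (intro presheaf_iso_if_bij[OF F P])
  then show ?thesis by (rule exI[of _ \<eta>])
qed

text \<open>What remains is smallness: \<open>matching X P U\<close> lies in a product over the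
  finite set \<open>irr_below X U\<close> of members of \<open>\<U>\<close>, so some injection codes
  it as a member of \<open>\<U>\<close>.\<close>

lemma restriction_essentially_surjective:
  fixes X :: "'a topology" and \<U> :: "'u set set"
  assumes \<U>: "set_universe \<U>" and fin: "finite (topspace X)"
  defines "Q \<equiv> {U. irreducible_open X U}"
  assumes P: "poset_presheaf \<U> Q P"
  shows "\<exists>F\<in>Ob (sheaf_topos \<U> X). \<exists>\<eta>. is_iso (poset_topos \<U> Q (\<subseteq>)) (restrict_presheaf Q F) P \<eta>"
proof -
  \<comment> \<open>Codes are obtained for every set \<open>U\<close>, open or not, since
    \<open>irr_below X U\<close> is always finite; thus \<open>e\<close> can be chosen as a total
    function without side conditions.\<close>
  have "\<exists>e. inj_on e (matching X P U) \<and> e ` matching X P U \<in> \<U>" for U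
  proof -
    have "FOb P V \<in> \<U>" if "V \<in> irr_below X U" for V
      using P irr_belowD(1)[OF that] by (simp add: poset_presheaf_iff Q_def)
    then obtain e where e: "inj_on e (Pi\<^sub>E (irr_below X U) (FOb P))" "e ` Pi\<^sub>E (irr_below X U) (FOb P) \<in> \<U>"
      using set_universe_PiE[OF \<U> finite_irr_below[OF fin]] by blast
    have sub: "matching X P U \<subseteq> Pi\<^sub>E (irr_below X U) (FOb P)"
      by (auto simp: matching_def)
    have "e ` matching X P U \<in> \<U>"
      using \<U> e(2) image_mono[OF sub, of e] unfolding set_universe_def by blast
    then show ?thesis
      using inj_on_subset[OF e(1) sub] by blast
  qed
  then obtain e where inj: "\<And>U. inj_on (e U) (matching X P U)" and small: "\<And>U. e U ` matching X P U \<in> \<U>"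
    by metis
  have "matching_sheaf X P e \<in> Ob (sheaf_topos \<U> X)"
    by (simp add: sheaf_topos_def poset_topos_def presheaf_matching_sheaf[OF inj small]
        extensional_matching_sheaf is_sheaf_matching_sheaf[OF fin inj])
  moreover have "\<exists>\<eta>. is_iso (poset_topos \<U> Q (\<subseteq>)) (restrict_presheaf Q (matching_sheaf X P e)) P \<eta>"
    using matching_sheaf_restrict_iso[OF P[unfolded Q_def] inj small] by (simp add: Q_def)
  ultimately show ?thesis by blast
qed

theorem proposition10:
  fixes X :: "'a topology" and \<U> :: "'u set set"
  assumes "set_universe \<U>"
    and "finite (topspace X)"
  shows "equivalent_categories (sheaf_topos \<U> X) (poset_topos \<U> {U. irreducible_open X U} (\<subseteq>))"
proof (rule equivalent_categories_if_fully_faithful)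
  let ?R = "restriction_functor {U. irreducible_open X U}"
  show "is_category (sheaf_topos \<U> X)"
    unfolding sheaf_topos_def by (intro is_category_full_subcat is_category_poset_topos)
  show "is_category (poset_topos \<U> {U. irreducible_open X U} (\<subseteq>))"
    by (rule is_category_poset_topos)
  show "is_functor (sheaf_topos \<U> X) (poset_topos \<U> {U. irreducible_open X U} (\<subseteq>)) ?R"
    unfolding sheaf_topos_def by (rule is_functor_restriction) (auto simp: irreducible_open_imp_openin)
  show "bij_betw (FHom ?R F G) (Hom (sheaf_topos \<U> X) F G)
      (Hom (poset_topos \<U> {U. irreducible_open X U} (\<subseteq>)) (FOb ?R F) (FOb ?R G))"
    if "F \<in> Ob (sheaf_topos \<U> X)" "G \<in> Ob (sheaf_topos \<U> X)" for F G
    using restriction_fully_faithful[OF assms(2), of \<U> F G] that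
    by (simp add: sheaf_topos_def poset_topos_def restriction_functor_def)
  show "\<exists>F\<in>Ob (sheaf_topos \<U> X). \<exists>\<eta>. is_iso (poset_topos \<U> {U. irreducible_open X U} (\<subseteq>)) (FOb ?R F) P \<eta>"
    if "P \<in> Ob (poset_topos \<U> {U. irreducible_open X U} (\<subseteq>))" for P
    using restriction_essentially_surjective[OF assms, of P] that
    by (simp add: poset_topos_def restriction_functor_def)
qed

end
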